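(* Let $X_1,X_2,\dots$ be i.i.d. real-valued continuous random variables and let $0<p<1$. For $\alpha\in\overline{\mathbb{H}}$ let $f^{(\alpha)}_p(x)=(x+\alpha)^p$ and $M^{f^{(\alpha)}_p}_n=\left(\frac1n\sum_{j=1}^n (X_j+\alpha)^p\right)^{1/p}-\alpha$. (i) If $X_1\in L^1$, then $M^{f^{(\alpha)}_p}_n\in L^1$ for every $\alpha\in\overline{\mathbb{H}}$ and $n\ge1$. (ii) If $X_1\notin L^1$, then $M^{f^{(\alpha)}_p}_n\notin L^1$ for every $\alpha\in\overline{\mathbb{H}}$ and $n\ge1$.
   Context: $\overline{\mathbb{H}}=\{z\in\mathbb{C}:\mathrm{Im}(z)\ge0\}$. Complex powers use the principal branch: $z^q=\exp(q\log z)$ with $\log z=\log r+i\theta$ for $z=r e^{i\theta}$, $r>0$, $\theta\in(-\pi,\pi]$; $0^p=0$ for $0<p<1$. A complex-valued random variable $Y$ is in $L^1$ if $E[|Y|]<+\infty$. "Continuous" random variable means that its distribution function is continuous, i.e. $P(X_1=x)=0$ for every $x\in\mathbb{R}$. *)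

theory Defs
  imports "HOL-Probability.Probability" "HOL-Complex_Analysis.Complex_Analysis"
begin

(* Complex powr is exp (q * Ln z) with Im (Ln z) in (-pi, pi], and 0 powr q = 0.  So for
   real x + \<alpha> < 0 it is the principal complex power, unlike real powr. *)

definition shifted_power :: "complex \<Rightarrow> real \<Rightarrow> real \<Rightarrow> complex" where
  "shifted_power \<alpha> p x = (complex_of_real x + \<alpha>) powr complex_of_real p"

definition power_mean ::
  "complex \<Rightarrow> real \<Rightarrow> (nat \<Rightarrow> 'a \<Rightarrow> real) \<Rightarrow> nat \<Rightarrow> 'a \<Rightarrow> complex" where
  "power_mean \<alpha> p X n \<omega> =
     ((\<Sum>j=1..n. shifted_power \<alpha> p (X j \<omega>)) / of_nat n) powr complex_of_real (1 / p) - \<alpha>"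

(* Consequently a failure of integrability of the mean can only come from E |M_n| = \<infinity>. *)
lemma borel_measurable_power_mean:
  assumes "\<And>j. j \<ge> 1 \<Longrightarrow> X j \<in> borel_measurable M"
  shows "power_mean \<alpha> p X n \<in> borel_measurable M"
proof -
  have [measurable]: "(\<lambda>\<omega>. shifted_power \<alpha> p (X j \<omega>)) \<in> borel_measurable M" if "j \<in> {1..n}" for j
  proof -
    have [measurable]: "X j \<in> borel_measurable M" using assms that by auto
    show ?thesis unfolding shifted_power_def by measurable
  qed
  have [measurable]: "(\<lambda>\<omega>. \<Sum>j=1..n. shifted_power \<alpha> p (X j \<omega>)) \<in> borel_measurable M"
    by (rule borel_measurable_sum) measurable
  show ?thesis unfolding power_mean_def [abs_def] by measurable
qed

end

theory Submission
  imports Defs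
begin

text \<open>
  Write \<open>z\<^sub>j = X\<^sub>j + \<alpha>\<close>, a point of the closed upper half-plane, and let \<open>S\<close> be the average of
  the \<open>z\<^sub>j\<^sup>p\<close>, so that the power mean is \<open>S\<close> raised to \<open>1/p\<close>, minus \<open>\<alpha>\<close>.  The proof compares
  \<open>\<bar>S\<bar>\<close> raised to \<open>1/p\<close> with the \<open>\<bar>z\<^sub>j\<bar>\<close> pointwise, up to constants that depend on \<open>n\<close>
  and \<open>p\<close> only.

  From above, the triangle inequality bounds \<open>\<bar>S\<bar>\<close> by the average of the \<open>\<bar>z\<^sub>j\<bar>\<^sup>p\<close>, hence
  by the \<open>p\<close>-th power of \<open>\<Sum> \<bar>z\<^sub>j\<bar>\<close>.  From below, the danger is cancellation among the
  \<open>z\<^sub>j\<^sup>p\<close>.  It cannot occur: the principal power maps the closed upper half-plane into the sector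
  of arguments in \<open>[0, p\<pi>]\<close>, and since \<open>p < 1\<close> this sector is narrower than a half-plane.
  Projected onto its bisector, every \<open>z\<^sub>j\<^sup>p\<close> keeps at least the fraction \<open>cos (p\<pi>/2) > 0\<close> of its
  modulus, and the projections add up.  Thus \<open>\<bar>S\<bar> \<ge> cos (p\<pi>/2) \<bar>z\<^sub>1\<bar>\<^sup>p / n\<close>.

  Both integrability claims follow by domination: the upper bound gives (i), as all \<open>X\<^sub>j\<close> have
  the same law, and the lower bound gives the contrapositive of (ii).
\<close>

section \<open>Modulus estimates in the closed upper half-plane\<close>

lemma norm_powr_of_real:
  fixes z :: complex and q :: real
  shows "norm (z powr complex_of_real q) = norm z powr q"
  by (simp add: powr_def)

lemma cos_half_angle_pos:
  fixes p :: real
  assumes "0 < p" "p < 1"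
  shows "0 < cos (p * pi / 2)"
proof (rule cos_gt_zero)
  show "0 < p * pi / 2" using assms by simp
  have "p * pi < 1 * pi" using assms(2) pi_gt_zero by (rule mult_strict_right_mono)
  then show "p * pi / 2 < pi / 2" by simp
qed

text \<open>
  The argument of \<open>z powr p\<close> lies in \<open>[0, p\<pi>]\<close>, hence differs from that of the bisector
  \<open>cis (p\<pi>/2)\<close> by at most \<open>p\<pi>/2\<close>.  Multiplying by \<open>cis (-p\<pi>/2)\<close> turns the bisector into the
  positive real axis, so that the projection onto it becomes a real part.
\<close>
lemma Re_rotated_powr_ge:
  fixes z :: complex and p :: real
  assumes "Im z \<ge> 0" "0 < p" "p < 1"
  shows "cos (p * pi / 2) * norm z powr p \<le> Re (z powr complex_of_real p * cis (- (p * pi / 2)))"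
proof (cases "z = 0")
  case True
  then show ?thesis by simp
next
  case False
  define t where "t = Im (Ln z)"
  have t: "0 \<le> t" "t \<le> pi"
    using assms(1) Im_Ln_pos_le[OF False] by (auto simp: t_def)
  have "z powr complex_of_real p * cis (- (p * pi / 2))
        = exp (complex_of_real p * Ln z + \<i> * complex_of_real (- (p * pi / 2)))"
    using False by (simp add: powr_def cis_conv_exp exp_add [symmetric])
  then have eq: "Re (z powr complex_of_real p * cis (- (p * pi / 2)))
                 = norm z powr p * cos (p * t - p * pi / 2)"
    using False by (simp add: Re_exp t_def powr_def)
  have "p * t \<le> p * pi" "0 \<le> p * t"
    using t assms by (auto intro: mult_left_mono)
  then have "\<bar>p * t - p * pi / 2\<bar> \<le> p * pi / 2"
    by linarith
  moreover have "p * pi / 2 \<le> pi"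
    using mult_strict_right_mono[OF assms(3) pi_gt_zero] pi_gt_zero by linarith
  ultimately have "cos (p * pi / 2) \<le> cos \<bar>p * t - p * pi / 2\<bar>"
    by (intro cos_monotone_0_pi_le) auto
  then have "cos (p * pi / 2) \<le> cos (p * t - p * pi / 2)"
    by simp
  then show ?thesis
    unfolding eq by (subst mult.commute) (intro mult_left_mono powr_ge_zero)
qed

text \<open>
  The projections of the summands onto the bisector are nonnegative, so the projection of the
  sum is at least that of any single summand.
\<close>
lemma norm_sum_powr_ge:
  fixes z :: "'i \<Rightarrow> complex" and p :: real
  assumes "finite A" "i \<in> A" "\<And>j. j \<in> A \<Longrightarrow> Im (z j) \<ge> 0" "0 < p" "p < 1"
  shows "cos (p * pi / 2) * norm (z i) powr p \<le> norm (\<Sum>j\<in>A. z j powr complex_of_real p)"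
proof -
  have c: "cos (p * pi / 2) \<ge> 0"
    using cos_half_angle_pos[OF assms(4,5)] by simp
  have "cos (p * pi / 2) * norm (z i) powr p \<le> (\<Sum>j\<in>A. cos (p * pi / 2) * norm (z j) powr p)"
    using assms c by (intro member_le_sum) auto
  also have "\<dots> \<le> (\<Sum>j\<in>A. Re (z j powr complex_of_real p * cis (- (p * pi / 2))))"
    using assms by (intro sum_mono Re_rotated_powr_ge) auto
  also have "\<dots> = Re ((\<Sum>j\<in>A. z j powr complex_of_real p) * cis (- (p * pi / 2)))"
    by (simp only: Re_sum sum_distrib_right)
  also have "\<dots> \<le> norm ((\<Sum>j\<in>A. z j powr complex_of_real p) * cis (- (p * pi / 2)))"
    by (rule complex_Re_le_cmod)
  finally show ?thesis by (simp add: norm_mult)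
qed

section \<open>Pointwise comparison of the power mean with the data\<close>

lemma norm_power_mean_add:
  assumes "n \<ge> 1"
  shows "norm (power_mean \<alpha> p X n \<omega> + \<alpha>)
         = (norm (\<Sum>j=1..n. (complex_of_real (X j \<omega>) + \<alpha>) powr complex_of_real p) / real n)
             powr (1 / p)"
proof -
  have "power_mean \<alpha> p X n \<omega> + \<alpha>
        = ((\<Sum>j=1..n. (complex_of_real (X j \<omega>) + \<alpha>) powr complex_of_real p) / of_nat n)
            powr complex_of_real (1 / p)"
    by (simp add: power_mean_def shifted_power_def)
  then show ?thesis
    by (simp only: norm_powr_of_real norm_divide norm_of_nat)
qed

text \<open>
  Bounding each modulus by the sum of all of them costs a factor compared with Jensen's inequality
  but is enough for integrability.
\<close>
lemma norm_power_mean_add_le: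
  assumes "n \<ge> 1" "0 < p"
  shows "norm (power_mean \<alpha> p X n \<omega> + \<alpha>) \<le> (\<Sum>j=1..n. norm (complex_of_real (X j \<omega>) + \<alpha>))"
proof -
  define T where "T = (\<Sum>j=1..n. norm (complex_of_real (X j \<omega>) + \<alpha>))"
  have T0: "T \<ge> 0" by (simp add: T_def sum_nonneg)
  let ?S = "\<Sum>j=1..n. (complex_of_real (X j \<omega>) + \<alpha>) powr complex_of_real p"
  have "norm ?S \<le> (\<Sum>j=1..n. norm (complex_of_real (X j \<omega>) + \<alpha>) powr p)"
    by (rule order_trans [OF norm_sum]) (simp add: norm_powr_of_real)
  also have "\<dots> \<le> (\<Sum>j=1..n. T powr p)"
  proof (rule sum_mono)
    fix j assume "j \<in> {1..n}"
    then have "norm (complex_of_real (X j \<omega>) + \<alpha>) \<le> T"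
      unfolding T_def by (intro member_le_sum) auto
    then show "norm (complex_of_real (X j \<omega>) + \<alpha>) powr p \<le> T powr p"
      using assms by (intro powr_mono2) auto
  qed
  finally have "norm ?S / real n \<le> T powr p"
    using assms by (simp add: field_simps)
  then have "(norm ?S / real n) powr (1 / p) \<le> (T powr p) powr (1 / p)"
    using assms by (intro powr_mono2) auto
  also have "\<dots> = T"
    using assms T0 by (simp add: powr_powr)
  finally show ?thesis
    unfolding T_def norm_power_mean_add[OF assms(1)] .
qed

lemma norm_power_mean_add_ge:
  assumes "i \<in> {1..n}" "Im \<alpha> \<ge> 0" "0 < p" "p < 1"
  shows "(cos (p * pi / 2) / real n) powr (1 / p) * norm (complex_of_real (X i \<omega>) + \<alpha>)
         \<le> norm (power_mean \<alpha> p X n \<omega> + \<alpha>)"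
proof -
  let ?S = "\<Sum>j=1..n. (complex_of_real (X j \<omega>) + \<alpha>) powr complex_of_real p"
  let ?y = "norm (complex_of_real (X i \<omega>) + \<alpha>)"
  have n: "n \<ge> 1" using assms by simp
  have c: "cos (p * pi / 2) \<ge> 0"
    using cos_half_angle_pos[OF assms(3,4)] by simp
  have "cos (p * pi / 2) * ?y powr p \<le> norm ?S"
    using assms by (intro norm_sum_powr_ge) auto
  then have "cos (p * pi / 2) / real n * ?y powr p \<le> norm ?S / real n"
    using n by (simp add: divide_right_mono)
  then have "(cos (p * pi / 2) / real n * ?y powr p) powr (1 / p) \<le> (norm ?S / real n) powr (1 / p)"
    using assms c by (intro powr_mono2) auto
  also have "(cos (p * pi / 2) / real n * ?y powr p) powr (1 / p)
             = (cos (p * pi / 2) / real n) powr (1 / p) * ?y"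
    using assms c by (subst powr_mult) (simp_all add: powr_powr)
  finally show ?thesis
    unfolding norm_power_mean_add[OF n] .
qed

section \<open>Integrability of power means\<close>

lemma (in finite_measure) integrable_power_mean:
  fixes X :: "nat \<Rightarrow> 'a \<Rightarrow> real"
  assumes "\<And>j. j \<ge> 1 \<Longrightarrow> integrable M (X j)" "n \<ge> 1" "0 < p"
  shows "integrable M (power_mean \<alpha> p X n)"
proof (rule Bochner_Integration.integrable_bound)
  show "integrable M (\<lambda>\<omega>. (\<Sum>j=1..n. norm (complex_of_real (X j \<omega>) + \<alpha>)) + norm \<alpha>)"
    using assms by (intro Bochner_Integration.integrable_add integrable_sum integrable_norm) auto
  show "power_mean \<alpha> p X n \<in> borel_measurable M"
    using assms by (intro borel_measurable_power_mean) auto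
  show "AE \<omega> in M. norm (power_mean \<alpha> p X n \<omega>)
          \<le> norm ((\<Sum>j=1..n. norm (complex_of_real (X j \<omega>) + \<alpha>)) + norm \<alpha>)"
  proof (rule AE_I2)
    fix \<omega>
    show "norm (power_mean \<alpha> p X n \<omega>)
          \<le> norm ((\<Sum>j=1..n. norm (complex_of_real (X j \<omega>) + \<alpha>)) + norm \<alpha>)"
      using norm_power_mean_add_le[of n p \<alpha> X \<omega>] assms
        norm_triangle_ineq4[of "power_mean \<alpha> p X n \<omega> + \<alpha>" \<alpha>]
      by simp
  qed
qed

lemma (in finite_measure) integrable_of_integrable_power_mean:
  fixes X :: "nat \<Rightarrow> 'a \<Rightarrow> real"
  assumes "integrable M (power_mean \<alpha> p X n)" "X i \<in> borel_measurable M"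
    "i \<in> {1..n}" "Im \<alpha> \<ge> 0" "0 < p" "p < 1"
  shows "integrable M (X i)"
proof (rule Bochner_Integration.integrable_bound)
  define C where "C = (cos (p * pi / 2) / real n) powr (1 / p)"
  have "cos (p * pi / 2) > 0"
    using assms by (intro cos_half_angle_pos)
  then have C: "C > 0"
    using assms by (simp add: C_def)
  show "integrable M (\<lambda>\<omega>. norm (power_mean \<alpha> p X n \<omega> + \<alpha>) / C + norm \<alpha>)"
    using assms by (intro Bochner_Integration.integrable_add integrable_norm integrable_divide) auto
  show "X i \<in> borel_measurable M" by fact
  show "AE \<omega> in M. norm (X i \<omega>) \<le> norm (norm (power_mean \<alpha> p X n \<omega> + \<alpha>) / C + norm \<alpha>)"
  proof (rule AE_I2)
    fix \<omega>
    have "C * norm (complex_of_real (X i \<omega>) + \<alpha>) \<le> norm (power_mean \<alpha> p X n \<omega> + \<alpha>)"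
      unfolding C_def using assms by (intro norm_power_mean_add_ge)
    then have "norm (complex_of_real (X i \<omega>) + \<alpha>) \<le> norm (power_mean \<alpha> p X n \<omega> + \<alpha>) / C"
      using C by (simp add: field_simps)
    moreover have "norm (X i \<omega>) \<le> norm (complex_of_real (X i \<omega>) + \<alpha>) + norm \<alpha>"
      using norm_triangle_ineq4[of "complex_of_real (X i \<omega>) + \<alpha>" \<alpha>] by simp
    ultimately show "norm (X i \<omega>) \<le> norm (norm (power_mean \<alpha> p X n \<omega> + \<alpha>) / C + norm \<alpha>)"
      by simp
  qed
qed

theorem proposition5p1:
  fixes M :: "'a measure" and X :: "nat \<Rightarrow> 'a \<Rightarrow> real" and p :: real
  assumes "prob_space M"
    and "prob_space.indep_vars M (\<lambda>_. borel) X {1..}"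
    and "\<forall>j\<ge>1. distr M borel (X j) = distr M borel (X 1)"
    and "continuous_on UNIV (cdf (distr M borel (X 1)))"
    and "0 < p" and "p < 1"
  shows "(integrable M (X 1) \<longrightarrow>
            (\<forall>\<alpha> n. Im \<alpha> \<ge> 0 \<and> n \<ge> 1 \<longrightarrow> integrable M (power_mean \<alpha> p X n)))
       \<and> (\<not> integrable M (X 1) \<longrightarrow>
            (\<forall>\<alpha> n. Im \<alpha> \<ge> 0 \<and> n \<ge> 1 \<longrightarrow> \<not> integrable M (power_mean \<alpha> p X n)))"
proof -
  interpret prob_space M by fact
  have meas: "X j \<in> borel_measurable M" if "j \<ge> 1" for j
    using assms(2) that by (auto simp: indep_vars_def)
  have same: "integrable M (X j) \<longleftrightarrow> integrable M (X 1)" if "j \<ge> 1" for j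
  proof -
    have "integrable M (X k) \<longleftrightarrow> integrable (distr M borel (X k)) (\<lambda>x. x)" if "k \<ge> 1" for k
      using meas[OF that] by (subst integrable_distr_eq) auto
    from this[OF that] this[of 1] show ?thesis
      unfolding assms(3)[rule_format, OF that] by simp
  qed
  show ?thesis
  proof (intro conjI impI allI)
    fix \<alpha> :: complex and n :: nat
    assume X1: "integrable M (X 1)" and n: "Im \<alpha> \<ge> 0 \<and> n \<ge> 1"
    show "integrable M (power_mean \<alpha> p X n)"
    proof (rule integrable_power_mean)
      show "integrable M (X j)" if "j \<ge> 1" for j
        unfolding same[OF that] by (rule X1)
    qed (use n assms(5) in simp_all)
  next
    fix \<alpha> :: complex and n :: nat
    assume "\<not> integrable M (X 1)" "Im \<alpha> \<ge> 0 \<and> n \<ge> 1"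
    then show "\<not> integrable M (power_mean \<alpha> p X n)"
      using integrable_of_integrable_power_mean[of \<alpha> p X n 1] meas assms(5,6) by auto
  qed
qed

end
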